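(* Let $(X,s)$ be a finite non-degenerate involutive set-theoretic solution of the Yang-Baxter equation (i.e. $X$ is finite). If its associated involutive Yang-Baxter group $\mathcal{G}(X,s)$ is abelian, then $(X,s)$ is a multipermutation solution.
   Context: Let $X$ be a non-empty set and $r\colon X^2\to X^2$ a map, written $r(x,y)=(\sigma_x(y),\gamma_y(x))$. The pair $(X,r)$ is a non-degenerate involutive set-theoretic solution of the Yang-Baxter equation if: $r^2=\mathrm{id}_{X^2}$; the maps $\sigma_x$ and $\gamma_x$ are bijections $X\to X$ for all $x\in X$; and $r_1r_2r_1=r_2r_1r_2$, where $r_1=r\times\mathrm{id}_X$ and $r_2=\mathrm{id}_X\times r$ as maps $X^3\to X^3$. $\mathcal{G}(X,r)$ denotes the subgroup of the symmetric group $\mathrm{Sym}_X$ generated by $\{\sigma_x\mid x\in X\}$; when $X$ is finite it is called the involutive Yang-Baxter (IYB) group associated to $(X,r)$. Retraction: define $x\sim y$ on $X$ if $\sigma_x=\sigma_y$. There is a (well-defined) induced non-degenerate involutive set-theoretic solution $\mathrm{Ret}(X,r)=(X/\!\sim,\tilde r)$ with $\tilde r([x],[y])=([\sigma_x(y)],[\gamma_y(x)])$, where $[x]$ is the $\sim$-class of $x$. Put $\mathrm{Ret}^0(X,r)=(X,r)$, $\mathrm{Ret}^1(X,r)=\mathrm{Ret}(X,r)$ and $\mathrm{Ret}^k(X,r)=\mathrm{Ret}(\mathrm{Ret}^{k-1}(X,r))$ for $k>1$. $(X,r)$ is a multipermutation solution if there is a nonnegative integer $m$ such that the underlying set of $\mathrm{Ret}^m(X,r)$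 has cardinality $1$; the smallest such $m$ is its multipermutation level. *)

theory Defs
  imports "HOL-Algebra.Bij" "HOL-Algebra.Generated_Groups" "HOL-Library.Disjoint_Sets"
begin

text \<open>A set with a map \<open>r\<close> on its square is a pair \<open>(X, r)\<close> with an explicit carrier \<open>X\<close>; the
  values of \<open>r\<close> outside \<open>X \<times> X\<close> are irrelevant.\<close>

type_synonym 'a yb_pair = "'a set \<times> ('a \<times> 'a \<Rightarrow> 'a \<times> 'a)"

text \<open>\<open>r (x, y) = (yb_sigma r x y, yb_gamma r y x)\<close>; note the order of the arguments of \<open>yb_gamma\<close>.\<close>

definition yb_sigma :: "('a \<times> 'a \<Rightarrow> 'a \<times> 'a) \<Rightarrow> 'a \<Rightarrow> 'a \<Rightarrow> 'a" where
  "yb_sigma r x y = fst (r (x, y))"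

definition yb_gamma :: "('a \<times> 'a \<Rightarrow> 'a \<times> 'a) \<Rightarrow> 'a \<Rightarrow> 'a \<Rightarrow> 'a" where
  "yb_gamma r y x = snd (r (x, y))"

definition yb_r1 :: "('a \<times> 'a \<Rightarrow> 'a \<times> 'a) \<Rightarrow> 'a \<times> 'a \<times> 'a \<Rightarrow> 'a \<times> 'a \<times> 'a" where
  "yb_r1 r = (\<lambda>(x, y, z). let (u, v) = r (x, y) in (u, v, z))"

definition yb_r2 :: "('a \<times> 'a \<Rightarrow> 'a \<times> 'a) \<Rightarrow> 'a \<times> 'a \<times> 'a \<Rightarrow> 'a \<times> 'a \<times> 'a" where
  "yb_r2 r = (\<lambda>(x, y, z). (x, r (y, z)))"

definition yb_solution :: "'a set \<Rightarrow> ('a \<times> 'a \<Rightarrow> 'a \<times> 'a) \<Rightarrow> bool" where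
  "yb_solution X r \<longleftrightarrow>
     X \<noteq> {} \<and>
     r \<in> X \<times> X \<rightarrow> X \<times> X \<and>
     (\<forall>p \<in> X \<times> X. r (r p) = p) \<and>
     (\<forall>x \<in> X. bij_betw (yb_sigma r x) X X) \<and>
     (\<forall>x \<in> X. bij_betw (yb_gamma r x) X X) \<and>
     (\<forall>t \<in> X \<times> X \<times> X. yb_r1 r (yb_r2 r (yb_r1 r t)) = yb_r2 r (yb_r1 r (yb_r2 r t)))"

text \<open>The elements of \<open>BijGroup X\<close> (the symmetric group of \<open>X\<close>) are extensional functions, hence the
  restriction of the generators to \<open>X\<close>.\<close>

definition yb_group :: "'a set \<Rightarrow> ('a \<times> 'a \<Rightarrow> 'a \<times> 'a) \<Rightarrow> ('a \<Rightarrow> 'a) monoid" where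
  "yb_group X r =
     (BijGroup X)\<lparr>carrier := generate (BijGroup X) ((\<lambda>x. restrict (yb_sigma r x) X) ` X)\<rparr>"

definition yb_ret_rel :: "'a set \<Rightarrow> ('a \<times> 'a \<Rightarrow> 'a \<times> 'a) \<Rightarrow> ('a \<times> 'a) set" where
  "yb_ret_rel X r = {(x, y) \<in> X \<times> X. \<forall>z \<in> X. yb_sigma r x z = yb_sigma r y z}"

text \<open>The map of the retraction sends \<open>(A, B)\<close> to the common value of
  \<open>([\<sigma>\<^sub>x(y)], [\<gamma>\<^sub>y(x)])\<close> over all representatives \<open>x \<in> A\<close>, \<open>y \<in> B\<close>.\<close>

definition yb_Ret :: "'a yb_pair \<Rightarrow> 'a set yb_pair" where
  "yb_Ret = (\<lambda>(X, r).
     (X // yb_ret_rel X r,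
      \<lambda>(A, B). the_elem
        ((\<lambda>(x, y). (yb_ret_rel X r `` {yb_sigma r x y}, yb_ret_rel X r `` {yb_gamma r y x}))
           ` (A \<times> B))))"

definition yb_transport :: "('a \<Rightarrow> 'b) \<Rightarrow> 'a yb_pair \<Rightarrow> 'b yb_pair" where
  "yb_transport f = (\<lambda>(X, r).
     (f ` X, \<lambda>(a, b). map_prod f f (r (inv_into X f a, inv_into X f b))))"

lemma yb_transport_iso:
  assumes "inj_on f X"
  shows "bij_betw f X (fst (yb_transport f (X, r)))"
    and "x \<in> X \<Longrightarrow> y \<in> X \<Longrightarrow> snd (yb_transport f (X, r)) (f x, f y) = map_prod f f (r (x, y))"
  using assms by (auto simp: yb_transport_def bij_betw_def)

text \<open>The type of \<open>yb_Ret S\<close> differs from that of \<open>S\<close>, so it cannot be iterated literally. Instead the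
  underlying set of \<open>Ret\<^sup>m\<close> is a partition of \<open>X\<close>: the elements \<open>x\<close> of \<open>X\<close> are identified
  with \<open>{x}\<close>, and a class of blocks of a partition of \<open>X\<close> is identified with its union. Both
  identifications are injective (see \<open>yb_Ret_pow_inj\<close>), so that \<open>yb_Ret_pow S 0\<close> is isomorphic to \<open>S\<close>
  and \<open>yb_Ret_pow S (Suc m)\<close> to \<open>yb_Ret (yb_Ret_pow S m)\<close>.\<close>

primrec yb_Ret_pow :: "'a yb_pair \<Rightarrow> nat \<Rightarrow> 'a set yb_pair" where
  "yb_Ret_pow S 0 = yb_transport (\<lambda>x. {x}) S"
| "yb_Ret_pow S (Suc m) = yb_transport \<Union> (yb_Ret (yb_Ret_pow S m))"

definition multipermutation_solution :: "'a set \<Rightarrow> ('a \<times> 'a \<Rightarrow> 'a \<times> 'a) \<Rightarrow> bool" where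
  "multipermutation_solution X r \<longleftrightarrow>
     yb_solution X r \<and> (\<exists>m. card (fst (yb_Ret_pow (X, r) m)) = 1)"

lemma equiv_yb_ret_rel: "equiv X (yb_ret_rel X r)"
proof (rule equivI)
  show "yb_ret_rel X r \<subseteq> X \<times> X" by (auto simp: yb_ret_rel_def)
  show "refl_on X (yb_ret_rel X r)" by (auto simp: yb_ret_rel_def refl_on_def)
  show "sym (yb_ret_rel X r)" by (auto simp: yb_ret_rel_def sym_def)
  show "trans (yb_ret_rel X r)" by (auto simp: yb_ret_rel_def trans_def)
qed

lemma inj_on_Union_yb_Ret:
  assumes "partition_on Y (fst S)"
  shows "inj_on \<Union> (fst (yb_Ret S))" and "partition_on Y (\<Union> ` fst (yb_Ret S))"
proof -
  obtain P r where S: "S = (P, r)" by (cases S)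
  have P: "partition_on Y P" using assms S by simp
  have F: "fst (yb_Ret S) = P // yb_ret_rel P r" by (simp add: yb_Ret_def S)
  have Q: "partition_on P (P // yb_ret_rel P r)"
    by (rule partition_on_quotient[OF equiv_yb_ret_rel])
  have sub: "C \<subseteq> P" if "C \<in> P // yb_ret_rel P r" for C
    using Q that unfolding partition_on_def by blast
  have mem: "B \<in> C"
    if C: "C \<in> P // yb_ret_rel P r" and B: "B \<in> P" "b \<in> B" "b \<in> \<Union>C" for B C b
  proof -
    obtain B' where B': "B' \<in> C" "b \<in> B'" using B(3) by blast
    then have "B' \<in> P" using sub[OF C] by blast
    then have "B' = B" using P B(1,2) B'(2) unfolding partition_on_def disjoint_def by blast
    then show ?thesis using B'(1) by simp
  qed
  have nonempty: "B \<noteq> {}" if "B \<in> P" for B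
    using P that unfolding partition_on_def by blast
  have subset: "C \<subseteq> D"
    if "C \<in> P // yb_ret_rel P r" "D \<in> P // yb_ret_rel P r" "\<Union>C = \<Union>D" for C D
  proof
    fix B assume B: "B \<in> C"
    then have BP: "B \<in> P" using sub[OF that(1)] by blast
    then obtain b where b: "b \<in> B" using nonempty by blast
    then have "b \<in> \<Union>D" using B that(3) by blast
    then show "B \<in> D" using mem[OF that(2) BP b] by blast
  qed
  show inj: "inj_on \<Union> (fst (yb_Ret S))"
    unfolding F
  proof (rule inj_onI)
    fix C D
    assume CD: "C \<in> P // yb_ret_rel P r" "D \<in> P // yb_ret_rel P r" "\<Union>C = \<Union>D"
    show "C = D" using subset[OF CD] subset[OF CD(2) CD(1) CD(3)[symmetric]] by (rule equalityI)
  qed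
  show "partition_on Y (\<Union> ` fst (yb_Ret S))"
    unfolding F
  proof (rule partition_onI)
    show "\<Union> (\<Union> ` (P // yb_ret_rel P r)) = Y"
      using P Q unfolding partition_on_def by blast
  next
    have "\<Union>C \<noteq> {}" if C: "C \<in> P // yb_ret_rel P r" for C
    proof -
      have "C \<noteq> {}" using C Q unfolding partition_on_def by blast
      then show ?thesis using sub[OF C] nonempty by blast
    qed
    then show "{} \<notin> \<Union> ` (P // yb_ret_rel P r)" by blast
  next
    fix p q assume "p \<in> \<Union> ` (P // yb_ret_rel P r)" "q \<in> \<Union> ` (P // yb_ret_rel P r)" "p \<noteq> q"
    then obtain C D where C: "C \<in> P // yb_ret_rel P r" "p = \<Union>C"
      and D: "D \<in> P // yb_ret_rel P r" "q = \<Union>D" and "C \<noteq> D" by blast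
    then have CD: "C \<inter> D = {}" using Q unfolding partition_on_def disjoint_def by blast
    show "disjnt p q"
      unfolding disjnt_iff
    proof (intro allI notI)
      fix b assume b: "b \<in> p \<and> b \<in> q"
      then obtain B where "B \<in> C" "b \<in> B" using C by blast
      moreover from this have "B \<in> D" using mem[OF D(1)] sub[OF C(1)] b D(2) by blast
      ultimately show False using CD by blast
    qed
  qed
qed

lemma partition_on_yb_Ret_pow: "partition_on (fst S) (fst (yb_Ret_pow S m))"
proof (induction m)
  case 0
  show ?case
    by (cases S) (auto simp: yb_transport_def partition_on_def disjoint_def)
next
  case (Suc m)
  then show ?case
    using inj_on_Union_yb_Ret(2)[OF Suc.IH]
    by (simp add: yb_transport_def case_prod_beta)
qed

lemma yb_Ret_pow_inj:
  "inj_on (\<lambda>x. {x}) (fst S)"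
  "inj_on \<Union> (fst (yb_Ret (yb_Ret_pow S m)))"
proof -
  show "inj_on (\<lambda>x. {x}) (fst S)" by simp
  show "inj_on \<Union> (fst (yb_Ret (yb_Ret_pow S m)))"
    by (rule inj_on_Union_yb_Ret(1)[OF partition_on_yb_Ret_pow])
qed

end

theory Submission
  imports Defs "HOL-Algebra.Ring" "HOL-Combinatorics.Permutations"
begin

text \<open>If \<open>G(X, r)\<close> is abelian and \<open>x \<mapsto> \<sigma>\<^sub>x\<close> is injective, then \<open>G(X, r)\<close> is a finite brace with
  commutative multiplication, in which \<open>\<sigma>\<^sub>x + a = a \<circ> \<sigma>\<^bsub>a'(x)\<^esub>\<close> with \<open>a'\<close> the inverse of \<open>a\<close>.
  Such a brace is a radical ring under \<open>a * b = a \<circ> b - a - b\<close>; being finite it is nilpotent, so unless it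
  is trivial some \<open>c \<noteq> 1\<close> is annihilated by everything. Then \<open>\<sigma>\<^sub>x \<circ> c = \<sigma>\<^sub>x + c = c \<circ> \<sigma>\<^bsub>c'(x)\<^esub>\<close>,
  hence \<open>\<sigma>\<^sub>x = \<sigma>\<^bsub>c'(x)\<^esub>\<close> and \<open>c\<close> fixes every point, a contradiction. So a solution with abelian group
  and more than one point has a strictly smaller retraction, whose group is again abelian.\<close>

section \<open>Annihilators in finite braces with commutative multiplication\<close>

text \<open>The ring structure is carried by a brace \<open>R\<close> whose \<open>\<otimes>\<close> is the circle operation
  \<open>a + b + a * b\<close> and not the ring product, called \<open>star\<close> in the proof. A nonzero \<open>c\<close> with smallest
  principal ideal is annihilated by everything: otherwise \<open>d = c * a\<close> generates the same ideal, so that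
  \<open>d = d * k\<close>, which forces \<open>d = 0\<close> in a radical ring.\<close>

lemma finite_commutative_brace_socle:
  fixes R (structure)
  assumes "abelian_group R" and "comm_group R" and fin: "finite (carrier R)"
    and brace: "\<And>a b c. \<lbrakk>a \<in> carrier R; b \<in> carrier R; c \<in> carrier R\<rbrakk>
      \<Longrightarrow> a \<otimes> (b \<oplus> c) \<oplus> a = a \<otimes> b \<oplus> a \<otimes> c"
    and nontrivial: "carrier R \<noteq> {\<one>}"
  shows "\<exists>c\<in>carrier R. c \<noteq> \<one> \<and> (\<forall>a\<in>carrier R. a \<otimes> c = a \<oplus> c)"
proof -
  interpret add: abelian_group R by fact
  interpret mult: comm_group R by fact
  \<comment> \<open>At these arguments the left side of \<open>brace\<close> is
    \<open>\<one>\<close> and the right side is \<open>\<zero>\<close>.\<close>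
  have one_zero: "\<one> = \<zero>"
    using brace[of \<one> \<zero> \<zero>] by simp
  define star where "star a b = a \<otimes> b \<ominus> a \<ominus> b" for a b
  have star_closed [simp]: "star a b \<in> carrier R" if "a \<in> carrier R" "b \<in> carrier R" for a b
    using that by (simp add: star_def)
  have mult_star: "a \<otimes> b = a \<oplus> b \<oplus> star a b" if "a \<in> carrier R" "b \<in> carrier R" for a b
  proof -
    have "a \<oplus> b \<oplus> star a b = a \<otimes> b \<oplus> (a \<oplus> \<ominus> a) \<oplus> (b \<oplus> \<ominus> b)"
      unfolding star_def a_minus_def using that
      by (simp only: add.a_ac mult.m_closed add.a_inv_closed add.add.m_closed)
    with that show ?thesis by (simp add: add.r_neg)
  qed
  have star_comm: "star a b = star b a" if "a \<in> carrier R" "b \<in> carrier R" for a b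
    using that by (simp add: star_def a_minus_def mult.m_comm add.a_ac)
  have star_add: "star a (b \<oplus> c) = star a b \<oplus> star a c"
    if abc: "a \<in> carrier R" "b \<in> carrier R" "c \<in> carrier R" for a b c
  proof -
    \<comment> \<open>Both sides of \<open>brace\<close> are expanded by \<open>mult_star\<close>;
      the bracketed sum is common to them and cancels.\<close>
    have "(a \<oplus> a \<oplus> b \<oplus> c) \<oplus> star a (b \<oplus> c) = (a \<oplus> a \<oplus> b \<oplus> c) \<oplus> (star a b \<oplus> star a c)"
      using brace[OF abc] abc by (simp add: mult_star add.a_ac)
    then show ?thesis using abc by simp
  qed
  have add_star: "star (a \<oplus> b) c = star a c \<oplus> star b c"
    if "a \<in> carrier R" "b \<in> carrier R" "c \<in> carrier R" for a b c
    using that star_add[of c a b] by (simp add: star_comm[of _ c])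
  have star_assoc: "star (star a b) c = star a (star b c)"
    if abc: "a \<in> carrier R" "b \<in> carrier R" "c \<in> carrier R" for a b c
  proof -
    have "(a \<oplus> b \<oplus> c \<oplus> star a b \<oplus> star a c \<oplus> star b c) \<oplus> star (star a b) c
        = (a \<oplus> b \<oplus> c \<oplus> star a b \<oplus> star a c \<oplus> star b c) \<oplus> star a (star b c)"
      using mult.m_assoc[OF abc] abc by (simp add: mult_star star_add add_star add.a_ac)
    then show ?thesis using abc by simp
  qed
  have zero_star: "star \<zero> a = \<zero>" if "a \<in> carrier R" for a
  proof -
    have "\<zero> \<otimes> a = a" using that mult.l_one one_zero by metis
    then have "a \<oplus> star \<zero> a = a \<oplus> \<zero>" using that by (simp add: mult_star)
    then show ?thesis using that by simp
  qed
  \<comment> \<open>This is where invertibility for the circle operation enters: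
    \<open>\<ominus> k \<otimes> d\<close> collapses to \<open>\<ominus> k\<close>, and cancelling
    gives \<open>d = \<one> = \<zero>\<close>.\<close>
  have star_fixed: "d = \<zero>" if "k \<in> carrier R" "d \<in> carrier R" "d = star k d" for k d
  proof -
    have "d \<oplus> star (\<ominus> k) d = \<zero>"
      using that add_star[of k "\<ominus> k" d] by (simp add: add.r_neg zero_star)
    then have "\<ominus> k \<otimes> d = \<ominus> k \<otimes> \<one>"
      using that by (simp add: mult_star add.a_assoc)
    then show ?thesis using that by (simp add: one_zero)
  qed
  have "\<not> carrier R \<subseteq> {\<zero>}"
    using nontrivial add.zero_closed unfolding one_zero by blast
  then obtain c0 where c0: "c0 \<in> carrier R \<and> c0 \<noteq> \<zero>" by blast
  from ex_has_least_nat[of "\<lambda>c. c \<in> carrier R \<and> c \<noteq> \<zero>", OF c0, of "\<lambda>c. card (star c ` carrier R)"]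
  obtain c where "(c \<in> carrier R \<and> c \<noteq> \<zero>) \<and> (\<forall>d. d \<in> carrier R \<and> d \<noteq> \<zero> \<longrightarrow>
      card (star c ` carrier R) \<le> card (star d ` carrier R))"
    by (rule exE)
  then have c: "c \<in> carrier R" "c \<noteq> \<zero>"
    and least: "\<And>d. d \<in> carrier R \<Longrightarrow> d \<noteq> \<zero>
      \<Longrightarrow> card (star c ` carrier R) \<le> card (star d ` carrier R)"
    by simp_all
  have "star a c = \<zero>" if a: "a \<in> carrier R" for a
  proof (rule ccontr)
    assume nz: "star a c \<noteq> \<zero>"
    let ?d = "star c a"
    have d: "?d \<in> carrier R" "?d \<noteq> \<zero>" using nz a c star_comm[OF a c(1)] by simp_all
    have "star ?d ` carrier R \<subseteq> star c ` carrier R"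
      using a c star_assoc by auto
    with least[OF d] fin have eq: "star ?d ` carrier R = star c ` carrier R"
      by (simp add: card_seteq)
    have "?d \<in> star ?d ` carrier R" unfolding eq using a by (rule imageI)
    then obtain k where k: "?d = star ?d k" "k \<in> carrier R" by (rule imageE)
    from k(1) star_comm[OF d(1) k(2)] have "?d = star k ?d" by (rule trans)
    with star_fixed[OF k(2) d(1)] d(2) show False by blast
  qed
  with c have "\<forall>a\<in>carrier R. a \<otimes> c = a \<oplus> c" by (simp add: mult_star)
  with c show ?thesis unfolding one_zero by blast
qed

section \<open>The brace of a finite commuting cycle set\<close>

lemma comp_commute:
  assumes "f \<circ> h = h \<circ> f" and "g \<circ> h = h \<circ> g"
  shows "(f \<circ> g) \<circ> h = h \<circ> (f \<circ> g)"
  using assms by (simp add: fun_eq_iff)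

text \<open>The cycle set product \<open>x \<cdot> y\<close> is
  \<open>inv_into UNIV (p x) y\<close>. The family \<open>p\<close> is total on the type, so
  composition and inversion need no membership conditions.\<close>

locale commuting_cycle_set =
  fixes X :: "'a set" and p :: "'a \<Rightarrow> 'a \<Rightarrow> 'a"
  assumes finite_X: "finite X"
    and permutes: "p x permutes X"
    and commute: "p x \<circ> p y = p y \<circ> p x"
    and cycle: "p x \<circ> p (inv_into UNIV (p x) y) = p y \<circ> p (inv_into UNIV (p y) x)"
begin

text \<open>\<open>perm\<close> is the cocycle from the free commutative monoid on \<open>X\<close> to permutations that sends a
  generator \<open>x\<close> to \<open>p x\<close>; words stand for multisets (see \<open>perm_mset\<close>).\<close>

fun perm :: "'a list \<Rightarrow> 'a \<Rightarrow> 'a" where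
  "perm [] = id"
| "perm (x # xs) = p x \<circ> perm (map (inv_into UNIV (p x)) xs)"

lemma perm_permutes: "perm u permutes X"
proof (induction u rule: perm.induct)
  case 1
  show ?case unfolding perm.simps by (rule permutes_id)
next
  case (2 x xs)
  then show ?case unfolding perm.simps by (rule permutes_compose) (rule permutes)
qed

lemma bij_perm: "bij (perm u)"
  using perm_permutes permutes_bij by blast

text \<open>The cocycle law. Inverting a composite reverses its factors, which is the order in which
  the letters of \<open>u\<close> shift \<open>v\<close>.\<close>

lemma perm_append: "perm (u @ v) = perm u \<circ> perm (map (inv_into UNIV (perm u)) v)"
proof (induction u arbitrary: v rule: perm.induct)
  case (2 x xs)
  have "inv_into UNIV (p x \<circ> perm (map (inv_into UNIV (p x)) xs)) = inv_into UNIV (perm (map (inv_into UNIV (p x)) xs)) \<circ> inv_into UNIV (p x)"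
    by (rule o_inv_distrib) (auto intro: bij_perm permutes_bij permutes)
  then show ?case by (simp only: append_Cons perm.simps map_append 2 comp_assoc map_map)
qed simp

text \<open>Moving \<open>v\<close> forward by \<open>perm u\<close> undoes the shift in the cocycle
  law; hence the values of \<open>perm\<close> are closed under composition.\<close>

lemma perm_comp: "perm u \<circ> perm v = perm (u @ map (perm u) v)"
  by (simp add: perm_append inv_o_cancel[OF bij_is_inj[OF bij_perm]])

lemma perm_singleton: "perm [x] = p x"
  by simp

text \<open>For two-letter words this is the axiom \<open>cycle\<close>; the cocycle law carries it
  to any tail.\<close>

lemma perm_swap: "perm (x # y # u) = perm (y # x # u)"
proof -
  have "perm [x, y] = perm [y, x]" by (simp add: cycle)
  then show ?thesis using perm_append[of "[x, y]" u] perm_append[of "[y, x]" u]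
    by simp
qed

text \<open>Induction is on length because unfolding \<open>perm\<close> replaces the tail by a
  shifted word, which is not a sublist.\<close>

lemma perm_move: "perm (u @ x # v) = perm (x # u @ v)"
proof (induction u arbitrary: x v rule: length_induct)
  case (1 u)
  show ?case
  proof (cases u)
    case (Cons y ys)
    have "perm (y # ys @ x # v) = p y \<circ> perm (map (inv_into UNIV (p y)) ys @ inv_into UNIV (p y) x # map (inv_into UNIV (p y)) v)"
      by simp
    also have "\<dots> = perm (y # x # ys @ v)"
      using 1 Cons by (simp only: perm.simps list.map map_append length_map length_Cons lessI)
    finally show ?thesis unfolding Cons append_Cons perm_swap[of y x "ys @ v"] .
  qed simp
qed

text \<open>The head of \<open>u\<close> is moved to the front of \<open>v\<close>; the shifted
  tails then have equal multisets and are shorter.\<close>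

lemma perm_mset: "mset u = mset v \<Longrightarrow> perm u = perm v"
proof (induction u arbitrary: v rule: length_induct)
  case (1 u)
  show ?case
  proof (cases u)
    case (Cons x xs)
    with "1.prems" have "x \<in> set v" by (metis list.set_intros(1) set_mset_mset)
    then obtain v1 v2 where v: "v = v1 @ x # v2" by (meson split_list)
    let ?g = "map (inv_into UNIV (p x))"
    have "mset (?g xs) = mset (?g (v1 @ v2))"
      using "1.prems" Cons v by (simp only: mset_map) simp
    with 1 Cons have "perm (?g xs) = perm (?g (v1 @ v2))"
      by (metis length_map length_Cons lessI)
    then have "perm (x # xs) = perm (x # v1 @ v2)" by (simp only: perm.simps)
    then show ?thesis unfolding Cons v perm_move .
  qed (use "1.prems" in simp)
qed

text \<open>Makes the brace addition well defined. By the cocycle law only \<open>perm u\<close>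
  matters for the left word; swapping the words gives the same for the right one.\<close>

lemma perm_append_cong:
  assumes "perm u = perm u'" and "perm v = perm v'"
  shows "perm (u @ v) = perm (u' @ v')"
proof -
  have "perm (u @ v) = perm (u' @ v)" using assms(1) by (simp add: perm_append)
  also have "\<dots> = perm (v @ u')" by (rule perm_mset) simp
  also have "\<dots> = perm (v' @ u')" using assms(2) by (simp add: perm_append)
  also have "\<dots> = perm (u' @ v')" by (rule perm_mset) simp
  finally show ?thesis .
qed

lemma finite_range_perm: "finite (range perm)"
  by (rule finite_subset[OF _ finite_permutations[OF finite_X]]) (auto intro: perm_permutes)

text \<open>Right composition with \<open>perm u\<close> is an injective self-map of a finite set,
  so it attains \<open>id\<close>.\<close>

lemma perm_inverse: "\<exists>v. perm v \<circ> perm u = id"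
proof -
  have cancel: "perm u \<circ> inv_into UNIV (perm u) = id"
    using bij_is_surj[OF bij_perm] surj_iff by blast
  have "inj_on (\<lambda>a. a \<circ> perm u) (range perm)"
  proof (rule inj_onI)
    fix a b assume "a \<circ> perm u = b \<circ> perm u"
    then have "a \<circ> (perm u \<circ> inv_into UNIV (perm u)) = b \<circ> (perm u \<circ> inv_into UNIV (perm u))"
      unfolding comp_assoc[symmetric] by (rule arg_cong)
    then show "a = b" unfolding cancel comp_id .
  qed
  moreover have "(\<lambda>a. a \<circ> perm u) ` range perm \<subseteq> range perm"
  proof clarify
    fix v
    show "perm v \<circ> perm u \<in> range perm" unfolding perm_comp by (rule rangeI)
  qed
  ultimately have "(\<lambda>a. a \<circ> perm u) ` range perm = range perm"
    using finite_range_perm by (simp only: endo_inj_surj)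
  moreover have "id \<in> range perm" unfolding perm.simps(1)[symmetric] by (rule rangeI)
  ultimately have "id \<in> (\<lambda>a. a \<circ> perm u) ` range perm" by (simp only:)
  then obtain a where a: "id = a \<circ> perm u" "a \<in> range perm" by (rule imageE)
  from a(2) obtain v where "a = perm v" by (rule rangeE)
  with a(1) have "perm v \<circ> perm u = id" by (simp only:)
  then show ?thesis by (rule exI)
qed

lemma p_perm_commute: "p x \<circ> perm u = perm u \<circ> p x"
proof (induction u rule: perm.induct)
  case (2 y u)
  from comp_commute[OF commute 2[symmetric]] show ?case
    unfolding perm.simps by (rule sym)
qed simp

lemma perm_commute: "perm u \<circ> perm v = perm v \<circ> perm u"
proof (induction u rule: perm.induct)
  case (2 x u)
  from comp_commute[OF p_perm_commute 2] show ?case unfolding perm.simps .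
qed simp

text \<open>Addition concatenates arbitrarily chosen words for \<open>a\<close> and
  \<open>b\<close>; the choice is immaterial by \<open>perm_append_cong\<close>. The
  \<open>ring\<close> record only supplies the two operations: its multiplication is the circle
  operation.\<close>

definition brace :: "('a \<Rightarrow> 'a) ring" where
  "brace = \<lparr>carrier = range perm, monoid.mult = (\<circ>), one = id, zero = id,
     add = (\<lambda>a b. perm (inv_into UNIV perm a @ inv_into UNIV perm b))\<rparr>"

lemma brace_simps:
  "carrier brace = range perm" "monoid.mult brace = (\<circ>)" "one brace = id" "zero brace = id"
  by (simp_all add: brace_def)

lemma brace_add: "perm u \<oplus>\<^bsub>brace\<^esub> perm v = perm (u @ v)"
  unfolding brace_def by (simp, rule perm_append_cong) (simp_all add: f_inv_into_f)

lemma comm_group_brace: "comm_group brace"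
proof (rule comm_groupI)
  show "\<one>\<^bsub>brace\<^esub> \<in> carrier brace" by (metis perm.simps(1) brace_simps(1,3) rangeI)
qed (auto simp: brace_simps perm_comp comp_assoc intro: perm_commute, use perm_inverse perm_comp in auto)

lemma abelian_group_brace: "abelian_group brace"
proof (rule abelian_groupI)
  show "\<zero>\<^bsub>brace\<^esub> \<in> carrier brace" by (metis perm.simps(1) brace_simps(1,4) rangeI)
  show "\<zero>\<^bsub>brace\<^esub> \<oplus>\<^bsub>brace\<^esub> a = a" if "a \<in> carrier brace" for a
    using that brace_add[of "[]"] by (auto simp: brace_simps)
  show "a \<oplus>\<^bsub>brace\<^esub> b = b \<oplus>\<^bsub>brace\<^esub> a" if "a \<in> carrier brace" "b \<in> carrier brace" for a b
    using that by (auto simp: brace_simps brace_add intro!: perm_mset)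
  show "\<exists>b\<in>carrier brace. b \<oplus>\<^bsub>brace\<^esub> a = \<zero>\<^bsub>brace\<^esub>" if "a \<in> carrier brace" for a
  proof -
    from that obtain u where u: "a = perm u" by (auto simp: brace_simps)
    obtain v where v: "perm v \<circ> perm u = id" using perm_inverse by blast
    txt \<open>The map \<open>b \<mapsto> b \<oplus> a\<close> is onto because \<open>a \<oplus> perm (map a v) = a \<circ> perm v\<close>.\<close>
    have "perm (map (perm u) v) \<oplus>\<^bsub>brace\<^esub> a = perm (u @ map (perm u) v)"
      unfolding u brace_add by (rule perm_mset) simp
    also have "\<dots> = id" using v perm_commute perm_comp by metis
    finally show ?thesis by (auto simp: brace_simps)
  qed
qed (auto simp: brace_simps brace_add)

text \<open>In terms of words, both sides contain the word of \<open>a\<close> twice and the words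
  of \<open>b\<close> and \<open>c\<close> shifted by \<open>a\<close>, so their multisets
  agree.\<close>

lemma brace_axiom:
  assumes "a \<in> carrier brace" "b \<in> carrier brace" "c \<in> carrier brace"
  shows "a \<otimes>\<^bsub>brace\<^esub> (b \<oplus>\<^bsub>brace\<^esub> c) \<oplus>\<^bsub>brace\<^esub> a = a \<otimes>\<^bsub>brace\<^esub> b \<oplus>\<^bsub>brace\<^esub> a \<otimes>\<^bsub>brace\<^esub> c"
  using assms by (auto simp: brace_simps brace_add perm_comp intro!: perm_mset)

lemma retractable:
  assumes "inj_on p X"
  shows "card X \<le> 1"
proof -
  \<comment> \<open>A trivial brace makes \<open>p\<close> constant, which together with injectivity
    leaves at most one point.\<close>
  have "range perm = {id}"
  proof (rule ccontr)
    assume nontrivial: "range perm \<noteq> {id}"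
    have "\<exists>c\<in>range perm. c \<noteq> id \<and> (\<forall>a\<in>range perm. a \<circ> c = a \<oplus>\<^bsub>brace\<^esub> c)"
      using finite_commutative_brace_socle[OF abelian_group_brace comm_group_brace _ brace_axiom]
        finite_range_perm nontrivial unfolding brace_simps by blast
    then obtain v where v: "perm v \<noteq> id"
      and socle: "\<And>u. perm u \<circ> perm v = perm u \<oplus>\<^bsub>brace\<^esub> perm v"
      by blast
    have fixed: "inv_into UNIV (perm v) x = x" if "x \<in> X" for x
    proof -
      have "p x \<circ> perm v = perm ([x] @ v)"
        using trans[OF socle brace_add, of "[x]"] unfolding perm_singleton .
      also have "\<dots> = perm (v @ [x])" by (rule perm_mset) simp
      also have "\<dots> = perm v \<circ> p (inv_into UNIV (perm v) x)" by (simp add: perm_append)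
      finally have eq: "perm v \<circ> p x = perm v \<circ> p (inv_into UNIV (perm v) x)"
        unfolding p_perm_commute .
      have "p x = p (inv_into UNIV (perm v) x)"
      proof
        show "p x z = p (inv_into UNIV (perm v) x) z" for z
          using fun_cong[OF eq, of z] bij_is_inj[OF bij_perm] by (simp add: inj_eq)
      qed
      moreover have "inv_into UNIV (perm v) x \<in> X"
        using that permutes_in_image[OF permutes_inv[OF perm_permutes]] by blast
      ultimately show ?thesis using inj_onD[OF assms _ that] by metis
    qed
    have "perm v x = x" for x
    proof (cases "x \<in> X")
      case True
      then show ?thesis
        using permutes_inverses(1)[OF perm_permutes, of v x] fixed by simp
    next
      case False
      then show ?thesis by (rule permutes_not_in[OF perm_permutes])
    qed
    with v show False by (auto simp: fun_eq_iff)
  qed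
  then have "perm [x] = id" for x by blast
  then have "p x = p y" for x y unfolding perm_singleton by simp
  then have "x = y" if "x \<in> X" "y \<in> X" for x y
    using inj_onD[OF assms _ that] by blast
  then show ?thesis using finite_X by (simp add: card_le_Suc0_iff_eq)
qed

end

section \<open>From solutions to cycle sets\<close>

text \<open>The two identities are the first coordinates of the braid relation and of
  involutivity.\<close>

lemma yb_solutionD:
  assumes "yb_solution X r" and "x \<in> X" "y \<in> X"
  shows yb_sigma_mem: "yb_sigma r x y \<in> X"
    and yb_gamma_mem: "yb_gamma r y x \<in> X"
    and yb_sigma_sigma: "z \<in> X \<Longrightarrow>
      yb_sigma r x (yb_sigma r y z) = yb_sigma r (yb_sigma r x y) (yb_sigma r (yb_gamma r y x) z)"
    and yb_sigma_gamma: "yb_sigma r (yb_sigma r x y) (yb_gamma r y x) = x"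
proof -
  have r: "r (x, y) \<in> X \<times> X" "r (r (x, y)) = (x, y)"
    using assms unfolding yb_solution_def by auto
  show "yb_sigma r x y \<in> X" "yb_gamma r y x \<in> X"
    "yb_sigma r (yb_sigma r x y) (yb_gamma r y x) = x"
    using r by (auto simp: yb_sigma_def yb_gamma_def mem_Times_iff)
  assume "z \<in> X"
  then have "yb_r1 r (yb_r2 r (yb_r1 r (x, y, z))) = yb_r2 r (yb_r1 r (yb_r2 r (x, y, z)))"
    using assms unfolding yb_solution_def by blast
  then show "yb_sigma r x (yb_sigma r y z) = yb_sigma r (yb_sigma r x y) (yb_sigma r (yb_gamma r y x) z)"
    by (simp add: yb_r1_def yb_r2_def yb_sigma_def yb_gamma_def Let_def split_beta)
qed

lemma yb_sigma_bij: "yb_solution X r \<Longrightarrow> x \<in> X \<Longrightarrow> bij_betw (yb_sigma r x) X X"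
  by (simp add: yb_solution_def)

text \<open>With \<open>u\<close> and \<open>v\<close> written as \<open>x \<cdot> y\<close> and \<open>y \<cdot> x\<close>, this is Rump's cycle set identity.\<close>

lemma yb_sigma_cycle:
  assumes X: "yb_solution X r" "x \<in> X" "y \<in> X" "z \<in> X" "u \<in> X" "v \<in> X"
    and u: "yb_sigma r x u = y" and v: "yb_sigma r y v = x"
  shows "yb_sigma r x (yb_sigma r u z) = yb_sigma r y (yb_sigma r v z)"
proof -
  have "yb_sigma r y (yb_gamma r u x) = x"
    using yb_sigma_gamma[OF X(1,2,5)] u by simp
  then have "yb_gamma r u x = v"
    using yb_sigma_bij[OF X(1,3)] v X yb_gamma_mem unfolding bij_betw_def inj_on_def by metis
  then show ?thesis using yb_sigma_sigma[OF X(1,2,5,4)] u by simp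
qed

lemma yb_solution_retractable:
  assumes X: "yb_solution X r" and fin: "finite X"
    and comm: "\<And>x y z. \<lbrakk>x \<in> X; y \<in> X; z \<in> X\<rbrakk>
      \<Longrightarrow> yb_sigma r x (yb_sigma r y z) = yb_sigma r y (yb_sigma r x z)"
    and card: "card X \<noteq> 1"
  shows "\<not> inj_on (\<lambda>x. yb_ret_rel X r `` {x}) X"
proof
  assume inj: "inj_on (\<lambda>x. yb_ret_rel X r `` {x}) X"
  \<comment> \<open>Extending by the identity, in the index as well as in the argument, makes the
    locale axioms hold on the whole type.\<close>
  define p where "p x z = (if x \<in> X \<and> z \<in> X then yb_sigma r x z else z)" for x z
  have p_in: "p x z = yb_sigma r x z" if "x \<in> X" "z \<in> X" for x z using that by (simp add: p_def)
  have p_out: "p x = id" if "x \<notin> X" for x using that by (auto simp: p_def)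
  have perm: "p x permutes X" for x
  proof (cases "x \<in> X")
    case True
    then have "bij_betw (p x) X X"
      using yb_sigma_bij[OF X True] by (simp add: p_def cong: bij_betw_cong)
    then show ?thesis by (rule bij_imp_permutes) (simp add: p_def)
  qed (simp add: p_out permutes_id)
  have cyc: "p x \<circ> p (inv_into UNIV (p x) y) = p y \<circ> p (inv_into UNIV (p y) x)" for x y
  proof -
    \<comment> \<open>An index outside \<open>X\<close> has the identity as its permutation and is
      fixed by the other one, so both sides reduce to the other permutation.\<close>
    consider "x \<in> X" "y \<in> X" | "x \<notin> X" | "y \<notin> X" by blast
    then show ?thesis
    proof cases
      case 1
      define u v where "u = inv_into UNIV (p x) y" and "v = inv_into UNIV (p y) x"
      have uv: "u \<in> X" "v \<in> X" "p x u = y" "p y v = x"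
        unfolding u_def v_def using 1 perm
        by (metis permutes_inv permutes_in_image, metis permutes_inv permutes_in_image,
            simp_all add: permutes_inverses(1)[OF perm])
      have "p x (p u z) = p y (p v z)" for z
      proof (cases "z \<in> X")
        case True
        then show ?thesis
          using yb_sigma_cycle[OF X 1 True uv(1,2)] uv 1
          by (simp add: p_in yb_sigma_mem[OF X])
      qed (simp add: p_def)
      then show ?thesis unfolding u_def v_def by auto
    next
      case 2
      then have "inv_into UNIV (p y) x = x" by (metis perm permutes_inv permutes_not_in)
      with 2 show ?thesis by (simp add: p_out)
    next
      case 3
      then have "inv_into UNIV (p x) y = y" by (metis perm permutes_inv permutes_not_in)
      with 3 show ?thesis by (simp add: p_out)
    qed
  qed
  interpret commuting_cycle_set X p
  proof
    show "p x \<circ> p y = p y \<circ> p x" for x y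
      by (auto simp: p_def comm yb_sigma_mem[OF X])
  qed (fact fin perm cyc)+
  have "inj_on p X"
  proof (rule inj_onI)
    fix x y assume xy: "x \<in> X" "y \<in> X" "p x = p y"
    then have "(x, y) \<in> yb_ret_rel X r"
      unfolding yb_ret_rel_def by (auto simp flip: p_in)
    with xy inj show "x = y"
      by (meson equiv_class_eq equiv_yb_ret_rel inj_onD)
  qed
  then have "card X \<le> 1" by (rule retractable)
  moreover have "card X \<noteq> 0" using X fin by (simp add: yb_solution_def)
  ultimately show False using card by simp
qed

section \<open>Homomorphic images and retractions\<close>

text \<open>Serves both relabelling and the passage to classes, where \<open>f\<close> may identify
  points. Surjectivity of the component maps descends along \<open>f\<close>, and finiteness turns
  it into bijectivity.\<close>

lemma yb_solution_image:
  assumes X: "yb_solution X r" and fin: "finite X"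
    and hom: "\<And>x y. \<lbrakk>x \<in> X; y \<in> X\<rbrakk> \<Longrightarrow> t (f x, f y) = map_prod f f (r (x, y))"
  shows "yb_solution (f ` X) t"
proof -
  have sigma: "yb_sigma t (f x) (f y) = f (yb_sigma r x y)"
    and gamma: "yb_gamma t (f y) (f x) = f (yb_gamma r y x)" if "x \<in> X" "y \<in> X" for x y
    using hom[OF that] by (simp_all add: yb_sigma_def yb_gamma_def)
  have r: "r (x, y) \<in> X \<times> X" "r (r (x, y)) = (x, y)" if "x \<in> X" "y \<in> X" for x y
    using X that unfolding yb_solution_def by auto
  have bij: "bij_betw g (f ` X) (f ` X)"
    if "bij_betw h X X" "\<And>x. x \<in> X \<Longrightarrow> g (f x) = f (h x)" for g h
  proof -
    have "g ` f ` X = f ` h ` X" using that(2) by (force simp: image_iff)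
    then have "g ` f ` X = f ` X" using that(1) by (simp add: bij_betw_def)
    then show ?thesis using fin by (simp add: bij_betw_def eq_card_imp_inj_on)
  qed
  let ?f = "map_prod f (map_prod f f)"
  have r1: "yb_r1 t (?f w) = ?f (yb_r1 r w)" "yb_r1 r w \<in> X \<times> X \<times> X"
    and r2: "yb_r2 t (?f w) = ?f (yb_r2 r w)" "yb_r2 r w \<in> X \<times> X \<times> X"
    if "w \<in> X \<times> X \<times> X" for w
    using that r hom
    by (cases w; auto simp: yb_r1_def yb_r2_def Let_def split_beta mem_Times_iff)+
  have braid: "yb_r1 t (yb_r2 t (yb_r1 t (?f w))) = yb_r2 t (yb_r1 t (yb_r2 t (?f w)))"
    if "w \<in> X \<times> X \<times> X" for w
  proof -
    have "yb_r1 r (yb_r2 r (yb_r1 r w)) = yb_r2 r (yb_r1 r (yb_r2 r w))"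
      using X that unfolding yb_solution_def by blast
    then show ?thesis using that by (simp add: r1 r2)
  qed
  have cube: "f ` X \<times> f ` X \<times> f ` X = ?f ` (X \<times> X \<times> X)"
    by (simp add: map_prod_surj_on)
  have inv: "t (f x, f y) \<in> f ` X \<times> f ` X \<and> t (t (f x, f y)) = (f x, f y)"
    if xy: "x \<in> X" "y \<in> X" for x y
  proof -
    obtain u v where uv: "r (x, y) = (u, v)" by fastforce
    then show ?thesis using r[OF xy] hom[OF xy] hom[of u v] by auto
  qed
  show ?thesis
    unfolding yb_solution_def cube
  proof (intro conjI)
    show "f ` X \<noteq> {}" using X by (simp add: yb_solution_def)
    show "\<forall>x\<in>f ` X. bij_betw (yb_sigma t x) (f ` X) (f ` X)"
      using X sigma bij unfolding yb_solution_def by blast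
    show "\<forall>x\<in>f ` X. bij_betw (yb_gamma t x) (f ` X) (f ` X)"
      using X gamma bij unfolding yb_solution_def by blast
    show "\<forall>w\<in>?f ` (X \<times> X \<times> X). yb_r1 t (yb_r2 t (yb_r1 t w)) = yb_r2 t (yb_r1 t (yb_r2 t w))"
    proof
      fix w assume "w \<in> ?f ` (X \<times> X \<times> X)"
      then obtain v where v: "w = ?f v" "v \<in> X \<times> X \<times> X" by (rule imageE)
      from braid[OF v(2)] show "yb_r1 t (yb_r2 t (yb_r1 t w)) = yb_r2 t (yb_r1 t (yb_r2 t w))"
        unfolding v(1) .
    qed
  qed (use inv in auto)
qed

text \<open>The invariant kept along the retractions: commutation of the generators, stated
  pointwise, passes to images more directly than commutativity of the generated group.\<close>

definition commuting_yb :: "'a yb_pair \<Rightarrow> bool" where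
  "commuting_yb = (\<lambda>(X, r). yb_solution X r \<and> finite X \<and>
     (\<forall>x\<in>X. \<forall>y\<in>X. \<forall>z\<in>X. yb_sigma r x (yb_sigma r y z) = yb_sigma r y (yb_sigma r x z)))"

lemma commuting_yb_image:
  assumes X: "commuting_yb (X, r)"
    and hom: "\<And>x y. \<lbrakk>x \<in> X; y \<in> X\<rbrakk> \<Longrightarrow> t (f x, f y) = map_prod f f (r (x, y))"
  shows "commuting_yb (f ` X, t)"
proof -
  have X': "yb_solution X r" "finite X" using X by (auto simp: commuting_yb_def)
  have sigma: "yb_sigma t (f x) (f y) = f (yb_sigma r x y)" if "x \<in> X" "y \<in> X" for x y
    using hom[OF that] by (simp add: yb_sigma_def)
  show ?thesis
    using X yb_solution_image[OF X' hom]
    by (simp add: commuting_yb_def sigma yb_sigma_mem[OF X'(1)])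
qed

lemma commuting_yb_transport:
  assumes "commuting_yb S" and "inj_on f (fst S)"
  shows "commuting_yb (yb_transport f S)"
proof -
  obtain X r where S: "S = (X, r)" by fastforce
  then show ?thesis
    using assms commuting_yb_image[of X r "snd (yb_transport f S)" f] yb_transport_iso(2)[of f X]
    by (simp add: yb_transport_def)
qed

text \<open>The cycle set identity speaks about preimages under \<open>yb_sigma r x\<close>, so
  compatibility is first shown for the inverse \<open>?s\<close>.\<close>

lemma yb_ret_rel_sigma:
  assumes X: "yb_solution X r" and fin: "finite X"
    and x: "x \<in> X" and yy: "(y, y') \<in> yb_ret_rel X r"
  shows "(yb_sigma r x y, yb_sigma r x y') \<in> yb_ret_rel X r"
proof -
  let ?R = "yb_ret_rel X r" and ?s = "inv_into X (yb_sigma r x)"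
  have bij: "bij_betw (yb_sigma r w) X X" if "w \<in> X" for w
    using yb_sigma_bij[OF X that] .
  have s: "?s w \<in> X" "yb_sigma r x (?s w) = w" if "w \<in> X" for w
    using bij[OF x] that by (auto simp: bij_betw_def inv_into_into f_inv_into_f)
  have s': "?s (yb_sigma r x w) = w" if "w \<in> X" for w
    using bij[OF x] that by (simp add: bij_betw_def)
  have "(?s w, ?s w') \<in> ?R" if ww: "(w, w') \<in> ?R" for w w'
  proof -
    have w: "w \<in> X" "w' \<in> X" and eq: "\<And>z. z \<in> X \<Longrightarrow> yb_sigma r w z = yb_sigma r w' z"
      using ww by (auto simp: yb_ret_rel_def)
    \<comment> \<open>Since \<open>w\<close> and \<open>w'\<close> act alike, \<open>v\<close> is
      the preimage of \<open>x\<close> under both, and the cycle set identity applies to each with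
      the same \<open>v\<close>.\<close>
    obtain v where v: "v \<in> X" "yb_sigma r w v = x"
      using bij[OF w(1)] x unfolding bij_betw_def by (metis imageE)
    have "yb_sigma r (?s w) z = yb_sigma r (?s w') z" if z: "z \<in> X" for z
    proof -
      have "yb_sigma r x (yb_sigma r (?s w) z) = yb_sigma r w (yb_sigma r v z)"
        using yb_sigma_cycle[OF X x w(1) z s(1)[OF w(1)] v(1) s(2)[OF w(1)] v(2)] .
      also have "\<dots> = yb_sigma r w' (yb_sigma r v z)"
        using eq yb_sigma_mem[OF X v(1) z] .
      also have "\<dots> = yb_sigma r x (yb_sigma r (?s w') z)"
        using yb_sigma_cycle[OF X x w(2) z s(1)[OF w(2)] v(1) s(2)[OF w(2)]] v eq by simp
      finally show ?thesis
        using bij[OF x] s(1) w z yb_sigma_mem[OF X] unfolding bij_betw_def inj_on_def by blast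
    qed
    then show ?thesis using s(1) w by (auto simp: yb_ret_rel_def)
  qed
  txt \<open>The inverse of \<open>\<sigma>\<^sub>x\<close> maps the finite relation into itself, hence onto itself.\<close>
  then have sub: "map_prod ?s ?s ` ?R \<subseteq> ?R" by auto
  have RX: "?R \<subseteq> X \<times> X" by (auto simp: yb_ret_rel_def)
  have "inj_on (map_prod ?s ?s) ?R"
    by (rule inj_on_subset[OF map_prod_inj_on RX])
      (use bij[OF x] in \<open>auto intro: inj_on_inv_into simp: bij_betw_def\<close>)
  with sub have "map_prod ?s ?s ` ?R = ?R"
    using fin RX by (meson endo_inj_surj finite_SigmaI finite_subset)
  with yy obtain w w' where ww: "(w, w') \<in> ?R" "y = ?s w" "y' = ?s w'" by force
  moreover from ww(1) have "w \<in> X" "w' \<in> X" using RX by auto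
  ultimately show ?thesis using s(2) by simp
qed

text \<open>For the second claim, the braid relation expresses the action of
  \<open>yb_gamma r y x\<close> through those of \<open>x\<close>, \<open>y\<close> and
  \<open>yb_sigma r x y\<close>, which depend only on the classes.\<close>

lemma yb_ret_rel_congruence:
  assumes X: "yb_solution X r" and fin: "finite X"
    and xx: "(x, x') \<in> yb_ret_rel X r" and yy: "(y, y') \<in> yb_ret_rel X r"
  shows "(yb_sigma r x y, yb_sigma r x' y') \<in> yb_ret_rel X r"
    and "(yb_gamma r y x, yb_gamma r y' x') \<in> yb_ret_rel X r"
proof -
  have mem: "x \<in> X" "x' \<in> X" "y \<in> X" "y' \<in> X"
    and eqx: "\<And>z. z \<in> X \<Longrightarrow> yb_sigma r x z = yb_sigma r x' z"
    and eqy: "\<And>z. z \<in> X \<Longrightarrow> yb_sigma r y z = yb_sigma r y' z"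
    using xx yy by (auto simp: yb_ret_rel_def)
  note sm = yb_sigma_mem[OF X] and gm = yb_gamma_mem[OF X]
  show S: "(yb_sigma r x y, yb_sigma r x' y') \<in> yb_ret_rel X r"
    using yb_ret_rel_sigma[OF X fin mem(1) yy] eqx mem by simp
  have "yb_sigma r (yb_gamma r y x) z = yb_sigma r (yb_gamma r y' x') z" if z: "z \<in> X" for z
  proof -
    let ?g = "yb_sigma r (yb_gamma r y x) z" and ?g' = "yb_sigma r (yb_gamma r y' x') z"
    have g: "?g \<in> X" "?g' \<in> X" using mem z sm gm by auto
    have "yb_sigma r (yb_sigma r x y) ?g = yb_sigma r (yb_sigma r x' y') ?g'"
      using yb_sigma_sigma[OF X mem(1,3) z] yb_sigma_sigma[OF X mem(2,4) z] eqx eqy mem z sm by simp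
    also have "\<dots> = yb_sigma r (yb_sigma r x y) ?g'"
      using S g by (simp add: yb_ret_rel_def)
    finally show ?thesis
      using yb_sigma_bij[OF X sm[OF mem(1,3)]] g unfolding bij_betw_def inj_on_def by blast
  qed
  then show "(yb_gamma r y x, yb_gamma r y' x') \<in> yb_ret_rel X r"
    using mem gm by (simp add: yb_ret_rel_def)
qed

lemma fst_yb_Ret: "fst (yb_Ret (X, r)) = (\<lambda>x. yb_ret_rel X r `` {x}) ` X"
  by (auto simp: yb_Ret_def quotient_def)

text \<open>By the congruence property the set inside \<open>the_elem\<close> is a singleton, so the
  class map is a homomorphism onto the retraction and the image lemma applies.\<close>

lemma commuting_yb_Ret:
  assumes "commuting_yb S"
  shows "commuting_yb (yb_Ret S)"
proof -
  obtain X r where S: "S = (X, r)" by fastforce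
  have X: "yb_solution X r" "finite X" using assms S by (auto simp: commuting_yb_def)
  let ?R = "yb_ret_rel X r"
  let ?q = "\<lambda>x. ?R `` {x}"
  have q: "?q a = ?q b" if "(a, b) \<in> ?R" for a b
    using that equiv_yb_ret_rel equiv_class_eq by metis
  have "snd (yb_Ret S) (?q x, ?q y) = map_prod ?q ?q (r (x, y))" if xy: "x \<in> X" "y \<in> X" for x y
  proof -
    have mem: "x \<in> ?q x" "y \<in> ?q y"
      using xy equiv_class_self[OF equiv_yb_ret_rel] by metis+
    have "(\<lambda>(x, y). (?q (yb_sigma r x y), ?q (yb_gamma r y x))) ` (?q x \<times> ?q y)
        = {(?q (yb_sigma r x y), ?q (yb_gamma r y x))}" (is "?g ` _ = {?c}")
    proof -
      have const: "?g w = ?c" if in_prod: "w \<in> ?q x \<times> ?q y" for w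
      proof -
        obtain a b where w: "w = (a, b)" "(x, a) \<in> ?R" "(y, b) \<in> ?R"
          using in_prod by (cases w) auto
        from yb_ret_rel_congruence[OF X w(2,3)] show ?thesis
          using q w(1) by simp
      qed
      have rep: "(x, y) \<in> ?q x \<times> ?q y" using mem by simp
      show ?thesis
      proof (rule equalityI)
        show "?g ` (?q x \<times> ?q y) \<subseteq> {?c}"
          by (rule image_subsetI) (simp only: const singleton_iff)
        show "{?c} \<subseteq> ?g ` (?q x \<times> ?q y)"
          using imageI[OF rep, of ?g] by (simp only: prod.case insert_subset empty_subsetI simp_thms)
      qed
    qed
    then have "snd (yb_Ret S) (?q x, ?q y) = ?c"
      by (simp only: S yb_Ret_def prod.case snd_conv the_elem_eq)
    then show ?thesis by (cases "r (x, y)") (simp add: yb_sigma_def yb_gamma_def)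
  qed
  then have "commuting_yb (?q ` X, snd (yb_Ret S))"
    by (rule commuting_yb_image[OF assms[unfolded S]])
  then have "commuting_yb (fst (yb_Ret S), snd (yb_Ret S))"
    unfolding S fst_yb_Ret .
  then show ?thesis by (simp only: prod.collapse)
qed

section \<open>Iterated retraction and termination\<close>

lemma commuting_yb_Ret_pow:
  assumes "commuting_yb S"
  shows "commuting_yb (yb_Ret_pow S m)"
proof (induction m)
  case 0
  show ?case using assms by (simp add: commuting_yb_transport)
next
  case (Suc m)
  then show ?case
    by (simp add: commuting_yb_transport commuting_yb_Ret yb_Ret_pow_inj)
qed

text \<open>The class map is not injective, so the number of classes drops; the identification by
  unions is injective and preserves that number.\<close>

lemma card_yb_Ret_pow_less:
  assumes "commuting_yb S" and "card (fst (yb_Ret_pow S m)) \<noteq> 1"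
  shows "card (fst (yb_Ret_pow S (Suc m))) < card (fst (yb_Ret_pow S m))"
proof -
  obtain Y t where Y: "yb_Ret_pow S m = (Y, t)" by fastforce
  have t: "yb_solution Y t" "finite Y"
    and comm: "\<And>x y z. \<lbrakk>x \<in> Y; y \<in> Y; z \<in> Y\<rbrakk>
      \<Longrightarrow> yb_sigma t x (yb_sigma t y z) = yb_sigma t y (yb_sigma t x z)"
    using commuting_yb_Ret_pow[OF assms(1), of m] Y by (auto simp: commuting_yb_def)
  have "\<not> inj_on (\<lambda>x. yb_ret_rel Y t `` {x}) Y"
    using yb_solution_retractable[OF t comm] assms(2) Y by simp
  then have "card (fst (yb_Ret (Y, t))) < card Y"
    unfolding fst_yb_Ret using t(2) by (metis card_image_le eq_card_imp_inj_on le_neq_implies_less)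
  moreover have "fst (yb_Ret_pow S (Suc m)) = \<Union> ` fst (yb_Ret (Y, t))"
    by (simp add: Y yb_transport_def split_beta)
  ultimately show ?thesis
    using yb_Ret_pow_inj(2)[of S m] Y by (simp add: card_image)
qed

theorem theorem6p5:
  fixes X :: "'a set" and s :: "'a \<times> 'a \<Rightarrow> 'a \<times> 'a"
  assumes "yb_solution X s"
    and "finite X"
    and "comm_group (yb_group X s)"
  shows "multipermutation_solution X s"
proof -
  interpret G: comm_group "yb_group X s" by fact
  let ?g = "\<lambda>x. restrict (yb_sigma s x) X"
  have gen: "?g x \<in> carrier (yb_group X s)" and bij: "?g x \<in> Bij X" if "x \<in> X" for x
    using that yb_sigma_bij[OF assms(1) that]
    by (auto simp: yb_group_def Bij_def intro: generate.incl cong: bij_betw_cong)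
  have "yb_sigma s x (yb_sigma s y z) = yb_sigma s y (yb_sigma s x z)"
    if "x \<in> X" "y \<in> X" "z \<in> X" for x y z
  proof -
    \<comment> \<open>The product in \<open>BijGroup X\<close> is \<open>compose X\<close>, so
      commutativity of the group yields the pointwise law at \<open>z\<close>.\<close>
    have "compose X (?g x) (?g y) = compose X (?g y) (?g x)"
      using G.m_comm[OF gen[OF that(1)] gen[OF that(2)]] bij that
      by (simp add: yb_group_def BijGroup_def)
    then have "compose X (?g x) (?g y) z = compose X (?g y) (?g x) z" by simp
    then show ?thesis using that yb_sigma_mem[OF assms(1)] by (simp add: compose_def)
  qed
  with assms have comm: "commuting_yb (X, s)" by (simp add: commuting_yb_def)
  let ?c = "\<lambda>m. card (fst (yb_Ret_pow (X, s) m))"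
  have "\<exists>m. ?c m = 1"
  proof (rule ccontr)
    assume "\<nexists>m. ?c m = 1"
    then have less: "?c (Suc m) < ?c m" for m
      using card_yb_Ret_pow_less[OF comm] by blast
    \<comment> \<open>Each retraction costs at least one point, so \<open>?c 0 + 1\<close> of them
      are impossible.\<close>
    have "?c m + m \<le> ?c 0" for m
    proof (induction m)
      case (Suc m)
      then show ?case using less[of m] by simp
    qed simp
    from this[of "Suc (?c 0)"] show False by simp
  qed
  with assms(1) show ?thesis by (simp add: multipermutation_solution_def)
qed

end
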